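(* Let $M$ be a taut complex manifold and let $(\varphi_{s,t})_{0\le s\le t<+\infty}$ be an evolution family on $M$. Then for every $0\le s\le t<+\infty$ the map $M\ni z\mapsto\varphi_{s,t}(z)\in M$ is univalent (i.e. holomorphic and injective).
   Context: Complex manifolds are connected, Hausdorff and second countable. $\|\cdot\|$ is a fixed Hermitian metric along the fibers of the complex tangent bundle $TM$, and $d_M(\cdot,\cdot)$ is the distance on $M$ induced by $\|\cdot\|$. $M$ is taut if every sequence of holomorphic maps from the unit disc $\mathbb{D}\subset\mathbb{C}$ to $M$ has a subsequence that either converges uniformly on compacta to a holomorphic map $\mathbb{D}\to M$ or is compactly divergent. An evolution family on $M$ is a family $(\varphi_{s,t})_{0\le s\le t<+\infty}$ of maps such that: (1) $\varphi_{s,s}=\mathrm{id}_M$ for all $s\ge0$; (2) $\varphi_{s,t}=\varphi_{u,t}\circ\varphi_{s,u}$ for all $0\le s\le u\le t<+\infty$; (3) $\varphi_{s,t}:M\to M$ is holomorphic for all $0\le s\le t<+\infty$; (4) for every $T>0$ and every compact set $K\subset M$ there is a constant $c_{T,K}>0$ such that $\sup_{z\in K}d_M(\varphi_{s,t}(z),\varphi_{s,t'}(z))\le c_{T,K}|t-t'|$ for all $s\geq 0$ and all $t,t'\in[s,T]$. *)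

theory Defs
  imports "HOL-Analysis.Analysis"
begin

section \<open>Complex manifolds\<close>

text \<open>Holomorphy in several variables; only ever used on open sets \<open>S\<close>.\<close>

definition vec_holomorphic_on ::
    "(complex^'n::finite \<Rightarrow> complex^'m::finite) \<Rightarrow> (complex^'n) set \<Rightarrow> bool" where
  "vec_holomorphic_on f S \<longleftrightarrow>
     (\<forall>z\<in>S. \<exists>D. (f has_derivative D) (at z) \<and> (\<forall>a v. D (a *s v) = a *s D v))"

text \<open>A chart is a pair of its domain and its coordinate map; the values of the coordinate map
  off the domain carry no meaning.\<close>

type_synonym ('a, 'n) chart = "'a set \<times> ('a \<Rightarrow> complex^'n)"

definition chart_inv :: "('a, 'n::finite) chart \<Rightarrow> complex^'n \<Rightarrow> 'a" where
  "chart_inv c = inv_into (fst c) (snd c)"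

definition transition :: "('a, 'n::finite) chart \<Rightarrow> ('a, 'n) chart \<Rightarrow> complex^'n \<Rightarrow> complex^'n" where
  "transition c d = snd d \<circ> chart_inv c"

definition is_chart :: "'a topology \<Rightarrow> ('a, 'n::finite) chart \<Rightarrow> bool" where
  "is_chart X c \<longleftrightarrow>
     openin X (fst c) \<and> open (snd c ` fst c) \<and>
     homeomorphic_map (subtopology X (fst c)) (top_of_set (snd c ` fst c)) (snd c)"

definition complex_atlas :: "'a topology \<Rightarrow> ('a, 'n::finite) chart set \<Rightarrow> bool" where
  "complex_atlas X A \<longleftrightarrow>
     (\<forall>c\<in>A. is_chart X c) \<and>
     (\<Union>c\<in>A. fst c) = topspace X \<and>
     (\<forall>c\<in>A. \<forall>d\<in>A. vec_holomorphic_on (transition c d) (snd c ` (fst c \<inter> fst d)))"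

definition complex_manifold :: "'a topology \<Rightarrow> ('a, 'n::finite) chart set \<Rightarrow> bool" where
  "complex_manifold X A \<longleftrightarrow>
     connected_space X \<and> Hausdorff_space X \<and> second_countable X \<and> complex_atlas X A"

definition holomorphic_map ::
    "'a topology \<Rightarrow> ('a, 'n::finite) chart set \<Rightarrow> 'b topology \<Rightarrow> ('b, 'm::finite) chart set \<Rightarrow> ('a \<Rightarrow> 'b) \<Rightarrow> bool"
  where
  "holomorphic_map X A Y B f \<longleftrightarrow>
     continuous_map X Y f \<and>
     (\<forall>c\<in>A. \<forall>d\<in>B. vec_holomorphic_on (snd d \<circ> f \<circ> chart_inv c) (snd c ` (fst c \<inter> f -` fst d)))"

definition univalent_map ::
    "'a topology \<Rightarrow> ('a, 'n::finite) chart set \<Rightarrow> 'b topology \<Rightarrow> ('b, 'm::finite) chart set \<Rightarrow> ('a \<Rightarrow> 'b) \<Rightarrow> bool"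
  where
  "univalent_map X A Y B f \<longleftrightarrow> holomorphic_map X A Y B f \<and> inj_on f (topspace X)"


section \<open>Hermitian metrics on the tangent bundle\<close>

text \<open>A tangent vector at \<open>p\<close> is the family of its coordinate vectors in the charts around \<open>p\<close>,
  related by the differentials of the transition maps. It is set to \<open>0\<close> at all other arguments,
  so that equality of families is equality of tangent vectors.\<close>

type_synonym ('a, 'n) tvec = "('a, 'n) chart \<Rightarrow> complex^'n"

definition tangent_space :: "('a, 'n::finite) chart set \<Rightarrow> 'a \<Rightarrow> ('a, 'n) tvec set" where
  "tangent_space A p =
     {v. (\<forall>c. \<not> (c \<in> A \<and> p \<in> fst c) \<longrightarrow> v c = 0) \<and>
         (\<forall>c\<in>A. \<forall>d\<in>A. p \<in> fst c \<inter> fst d \<longrightarrow>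
            v d = frechet_derivative (transition c d) (at (snd c p)) (v c))}"

definition tvec_of_coords ::
    "('a, 'n::finite) chart set \<Rightarrow> ('a, 'n) chart \<Rightarrow> 'a \<Rightarrow> complex^'n \<Rightarrow> ('a, 'n) tvec" where
  "tvec_of_coords A c p x =
     (\<lambda>d. if d \<in> A \<and> p \<in> fst d
          then frechet_derivative (transition c d) (at (snd c p)) x else 0)"

text \<open>Real differentiability of class \<open>C\<^sup>k\<close> on an open set \<open>S\<close>, via directional derivatives.\<close>

primrec Ck_on ::
    "nat \<Rightarrow> ('a::real_normed_vector \<Rightarrow> 'b::real_normed_vector) \<Rightarrow> 'a set \<Rightarrow> bool" where
  "Ck_on 0 f S \<longleftrightarrow> continuous_on S f"
| "Ck_on (Suc k) f S \<longleftrightarrow>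
     (\<forall>x\<in>S. f differentiable (at x)) \<and>
     (\<forall>v. Ck_on k (\<lambda>x. frechet_derivative f (at x) v) S)"

definition smooth_on ::
    "('a::real_normed_vector \<Rightarrow> 'b::real_normed_vector) \<Rightarrow> 'a set \<Rightarrow> bool" where
  "smooth_on f S \<longleftrightarrow> (\<forall>k. Ck_on k f S)"

definition hermitian_metric ::
    "'a topology \<Rightarrow> ('a, 'n::finite) chart set \<Rightarrow>
     ('a \<Rightarrow> ('a, 'n) tvec \<Rightarrow> ('a, 'n) tvec \<Rightarrow> complex) \<Rightarrow> bool" where
  "hermitian_metric X A h \<longleftrightarrow>
     (\<forall>p\<in>topspace X.
        (\<forall>u\<in>tangent_space A p. \<forall>v\<in>tangent_space A p. \<forall>w\<in>tangent_space A p.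
           h p (\<lambda>c. u c + v c) w = h p u w + h p v w) \<and>
        (\<forall>a. \<forall>v\<in>tangent_space A p. \<forall>w\<in>tangent_space A p.
           h p (\<lambda>c. a *s v c) w = a * h p v w) \<and>
        (\<forall>v\<in>tangent_space A p. \<forall>w\<in>tangent_space A p. h p w v = cnj (h p v w)) \<and>
        (\<forall>v\<in>tangent_space A p. v \<noteq> (\<lambda>c. 0) \<longrightarrow> 0 < Re (h p v v))) \<and>
     (\<forall>c\<in>A. \<forall>x y.
        smooth_on
          (\<lambda>z. let p = chart_inv c z in h p (tvec_of_coords A c p x) (tvec_of_coords A c p y))
          (snd c ` fst c))"


section \<open>The induced distance\<close>

definition piecewise_C1_curve ::
    "'a topology \<Rightarrow> ('a, 'n::finite) chart set \<Rightarrow> (real \<Rightarrow> 'a) \<Rightarrow> bool" where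
  "piecewise_C1_curve X A \<gamma> \<longleftrightarrow>
     continuous_map (top_of_set {0..1}) X \<gamma> \<and>
     (\<forall>c\<in>A. \<forall>a b. 0 \<le> a \<and> a \<le> b \<and> b \<le> 1 \<and> \<gamma> ` {a..b} \<subseteq> fst c \<longrightarrow>
        (snd c \<circ> \<gamma>) piecewise_C1_differentiable_on {a..b})"

definition velocity :: "('a, 'n::finite) chart set \<Rightarrow> (real \<Rightarrow> 'a) \<Rightarrow> real \<Rightarrow> ('a, 'n) tvec" where
  "velocity A \<gamma> t =
     (\<lambda>c. if c \<in> A \<and> \<gamma> t \<in> fst c then vector_derivative (snd c \<circ> \<gamma>) (at t) else 0)"

text \<open>The velocity is meaningful off the finitely many break points, which form a null set.
  The integral is taken in \<open>ennreal\<close> because the library's piecewise \<open>C\<^sup>1\<close> notion allows the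
  derivative to be unbounded near a break point, so that a length may be infinite; such curves
  do not change the infimum.\<close>

definition curve_length ::
    "('a, 'n::finite) chart set \<Rightarrow> ('a \<Rightarrow> ('a, 'n) tvec \<Rightarrow> ('a, 'n) tvec \<Rightarrow> complex) \<Rightarrow>
     (real \<Rightarrow> 'a) \<Rightarrow> ennreal" where
  "curve_length A h \<gamma> =
     (\<integral>\<^sup>+ t\<in>{0..1}. ennreal (sqrt (Re (h (\<gamma> t) (velocity A \<gamma> t) (velocity A \<gamma> t)))) \<partial>lborel)"

definition manifold_dist ::
    "'a topology \<Rightarrow> ('a, 'n::finite) chart set \<Rightarrow>
     ('a \<Rightarrow> ('a, 'n) tvec \<Rightarrow> ('a, 'n) tvec \<Rightarrow> complex) \<Rightarrow> 'a \<Rightarrow> 'a \<Rightarrow> ennreal" where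
  "manifold_dist X A h p q =
     (INF \<gamma>\<in>{\<gamma>. piecewise_C1_curve X A \<gamma> \<and> \<gamma> 0 = p \<and> \<gamma> 1 = q}. curve_length A h \<gamma>)"


section \<open>Taut manifolds\<close>

abbreviation unit_disc :: "complex set" where
  "unit_disc \<equiv> ball 0 1"

definition holomorphic_disc ::
    "'a topology \<Rightarrow> ('a, 'n::finite) chart set \<Rightarrow> (complex \<Rightarrow> 'a) \<Rightarrow> bool" where
  "holomorphic_disc X A f \<longleftrightarrow>
     continuous_map (top_of_set unit_disc) X f \<and>
     (\<forall>c\<in>A. \<forall>i. (\<lambda>z. snd c (f z) $ i) holomorphic_on (unit_disc \<inter> f -` fst c))"

definition conv_unif_on_compacta ::
    "'a topology \<Rightarrow> ('a, 'n::finite) chart set \<Rightarrow>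
     ('a \<Rightarrow> ('a, 'n) tvec \<Rightarrow> ('a, 'n) tvec \<Rightarrow> complex) \<Rightarrow>
     (nat \<Rightarrow> complex \<Rightarrow> 'a) \<Rightarrow> (complex \<Rightarrow> 'a) \<Rightarrow> bool" where
  "conv_unif_on_compacta X A h f g \<longleftrightarrow>
     (\<forall>K. compact K \<and> K \<subseteq> unit_disc \<longrightarrow>
        (\<forall>\<epsilon>>0. \<forall>\<^sub>F n in sequentially. \<forall>z\<in>K. manifold_dist X A h (f n z) (g z) < \<epsilon>))"

definition compactly_divergent :: "'a topology \<Rightarrow> (nat \<Rightarrow> complex \<Rightarrow> 'a) \<Rightarrow> bool" where
  "compactly_divergent X f \<longleftrightarrow>
     (\<forall>K L. compact K \<and> K \<subseteq> unit_disc \<and> compactin X L \<longrightarrow>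
        (\<forall>\<^sub>F n in sequentially. f n ` K \<inter> L = {}))"

text \<open>The metric \<open>h\<close> enters only through uniform convergence on compacta, measured by the induced
  distance; the notion does not depend on its choice.\<close>

definition taut ::
    "'a topology \<Rightarrow> ('a, 'n::finite) chart set \<Rightarrow>
     ('a \<Rightarrow> ('a, 'n) tvec \<Rightarrow> ('a, 'n) tvec \<Rightarrow> complex) \<Rightarrow> bool" where
  "taut X A h \<longleftrightarrow>
     (\<forall>f. (\<forall>n. holomorphic_disc X A (f n)) \<longrightarrow>
        (\<exists>r::nat \<Rightarrow> nat. strict_mono r \<and>
           ((\<exists>g. holomorphic_disc X A g \<and> conv_unif_on_compacta X A h (f \<circ> r) g) \<or>
            compactly_divergent X (f \<circ> r))))"


section \<open>Evolution families\<close>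

text \<open>\<open>\<phi> s t\<close> is only constrained for \<open>0 \<le> s \<le> t\<close>.\<close>

definition evolution_family ::
    "'a topology \<Rightarrow> ('a, 'n::finite) chart set \<Rightarrow>
     ('a \<Rightarrow> ('a, 'n) tvec \<Rightarrow> ('a, 'n) tvec \<Rightarrow> complex) \<Rightarrow>
     (real \<Rightarrow> real \<Rightarrow> 'a \<Rightarrow> 'a) \<Rightarrow> bool" where
  "evolution_family X A h \<phi> \<longleftrightarrow>
     (\<forall>s\<ge>0. \<forall>z\<in>topspace X. \<phi> s s z = z) \<and>
     (\<forall>s u t. 0 \<le> s \<and> s \<le> u \<and> u \<le> t \<longrightarrow>
        (\<forall>z\<in>topspace X. \<phi> s t z = \<phi> u t (\<phi> s u z))) \<and>
     (\<forall>s t. 0 \<le> s \<and> s \<le> t \<longrightarrow> holomorphic_map X A X A (\<phi> s t)) \<and>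
     (\<forall>T>0. \<forall>K. compactin X K \<longrightarrow>
        (\<exists>C::real. C > 0 \<and>
           (\<forall>s\<ge>0. \<forall>t\<in>{s..T}. \<forall>t'\<in>{s..T}.
              (SUP z\<in>K. manifold_dist X A h (\<phi> s t z) (\<phi> s t' z)) \<le> ennreal (C * \<bar>t - t'\<bar>))))"

end

theory Submission
  imports Defs "HOL-Complex_Analysis.Cauchy_Integral_Formula"
begin

text \<open>Suppose that two trajectories meet: \<open>\<phi> s t z = \<phi> s t w\<close>. Trajectories are continuous in
  time and \<open>M\<close> is Hausdorff, so there is a first time \<open>\<tau>\<close> at which \<open>\<phi> s \<tau> z = \<phi> s \<tau> w\<close>; call this
  common value \<open>p\<close>. If \<open>\<tau> = s\<close>, then \<open>z = w\<close>. Otherwise consider times \<open>u < \<tau>\<close> close to \<open>\<tau>\<close>: the points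
  \<open>\<phi> s u z\<close> and \<open>\<phi> s u w\<close> are close to \<open>p\<close> and are both sent to \<open>p\<close> by \<open>\<phi> u \<tau>\<close>. But the Lipschitz
  condition compares \<open>\<phi> u \<tau>\<close> with \<open>\<phi> u u = id\<close> with a constant that does not depend on \<open>u\<close>, so
  \<open>\<phi> u \<tau>\<close> tends to the identity uniformly near \<open>p\<close> as \<open>u\<close> increases to \<open>\<tau>\<close>. A holomorphic map that is
  uniformly close to the identity on a ball is injective on a smaller concentric ball, by Cauchy's
  estimate for the derivative of the difference. Hence the two trajectories already agree at
  time \<open>u\<close>, against the choice of \<open>\<tau>\<close>.

  The Lipschitz condition speaks of the distance induced by the Hermitian metric, while Cauchy's
  estimate is applied in a chart. The two are linked by \<open>manifold_dist_controls_chart\<close>: near a given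
  point, a small induced distance forces a small distance of coordinates. On a compact piece of a
  chart the metric dominates a positive multiple of the Euclidean norm, so a short curve has a
  small coordinate displacement and cannot reach the boundary of that piece. The resulting
  uniform local injectivity is \<open>evolution_family_locally_injective\<close>.\<close>

section \<open>Holomorphic maps close to the identity\<close>

lemma bounded_linear_scale_left: "bounded_linear (\<lambda>\<zeta>::complex. \<zeta> *s (v::complex^'n))"
  by (intro linear_linear[THEN iffD2] linearI) (auto simp: vec_eq_iff algebra_simps)

lemma has_derivative_vec_nth:
  fixes f :: "'b::real_normed_vector \<Rightarrow> complex^'m::finite"
  assumes "(f has_derivative D) F"
  shows "((\<lambda>x. f x $ i) has_derivative (\<lambda>x. D x $ i)) F"
  by (rule bounded_linear.has_derivative[OF bounded_linear_vec_nth assms])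

lemma norm_scale_vec: "norm (a *s (v::complex^'n)) = cmod a * norm v"
  by (simp add: norm_vec_def norm_mult L2_set_right_distrib)

text \<open>If \<open>f z = f w\<close>, then \<open>g = f - id\<close> changes by \<open>z - w\<close> between \<open>z\<close> and \<open>w\<close>. In the complex line
  through these points \<open>g\<close> is bounded by \<open>\<delta>\<close> on discs of radius \<open>r / 4\<close> centred on the segment, so
  by Cauchy's estimate each of the \<open>n\<close> components of \<open>g\<close> changes by at most
  \<open>(4 * \<delta> / r) * norm (w - z)\<close>, which is less than \<open>norm (w - z) / n\<close>. This is too little for
  their sum.\<close>

lemma holomorphic_near_identity_inj_on:
  fixes f :: "complex^'n::finite \<Rightarrow> complex^'n"
  assumes hol: "vec_holomorphic_on f (ball a r)"
    and close: "\<And>z. z \<in> ball a r \<Longrightarrow> norm (f z - z) \<le> \<delta>"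
    and "0 < r" "4 * real CARD('n) * \<delta> < r"
  shows "inj_on f (ball a (r / 8))"
proof (rule inj_onI, rule ccontr)
  fix z w assume z: "z \<in> ball a (r / 8)" and w: "w \<in> ball a (r / 8)"
    and eq: "f z = f w" and "z \<noteq> w"
  define v where "v = w - z"
  have v0: "0 < norm v" using \<open>z \<noteq> w\<close> by (simp add: v_def)
  have vr: "norm v < r / 4"
    using z w norm_triangle_ineq4[of "w - a" "z - a"] by (simp add: v_def dist_norm norm_minus_commute)
  \<comment> \<open>A disc of radius \<open>\<rho>\<close> for the parameter \<open>\<xi>\<close> is a disc of radius \<open>r / 4\<close> in the line
    \<open>z + \<xi> *s v\<close>. It stays inside \<open>ball a r\<close> when centred in the closed unit disc, since
    \<open>norm (z - a) < r / 8\<close> and \<open>norm v < r / 4\<close>.\<close>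
  define \<rho> where "\<rho> = r / (4 * norm v)"
  have \<rho>: "0 < \<rho>" "\<rho> * norm v = r / 4" using v0 \<open>0 < r\<close> by (auto simp: \<rho>_def)
  have inball: "z + \<xi> *s v \<in> ball a r" if "cmod \<xi> \<le> 1 + \<rho>" for \<xi>
  proof -
    have "norm (\<xi> *s v) \<le> (1 + \<rho>) * norm v"
      unfolding norm_scale_vec using that by (intro mult_right_mono) auto
    then have "norm (\<xi> *s v) \<le> norm v + r / 4"
      using \<rho>(2) by (simp add: algebra_simps)
    moreover have "norm (z + \<xi> *s v - a) \<le> norm (z - a) + norm (\<xi> *s v)"
      using norm_triangle_ineq[of "z - a" "\<xi> *s v"] by (simp add: algebra_simps)
    ultimately show ?thesis
      using vr z \<open>0 < r\<close> by (simp add: dist_norm norm_minus_commute)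
  qed
  have comp: "cmod (v $ i) \<le> \<delta> / \<rho>" for i
  proof -
    define g where "g = (\<lambda>\<xi>. f (z + \<xi> *s v) $ i - (z + \<xi> *s v) $ i)"
    have der: "\<exists>d. (g has_field_derivative d) (at \<xi>)" if \<xi>: "cmod \<xi> \<le> 1 + \<rho>" for \<xi>
    proof -
      obtain D where D: "(f has_derivative D) (at (z + \<xi> *s v))"
        and lin: "\<And>b x. D (b *s x) = b *s D x"
        using hol inball[OF \<xi>] unfolding vec_holomorphic_on_def by blast
      have L: "((\<lambda>\<xi>. z + \<xi> *s v) has_derivative (\<lambda>k. k *s v)) (at \<xi>)"
        by (rule has_derivative_eq_rhs, rule has_derivative_add[OF has_derivative_const
              bounded_linear.has_derivative[OF bounded_linear_scale_left has_derivative_ident]]) simp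
      have "((\<lambda>\<xi>. f (z + \<xi> *s v)) has_derivative (\<lambda>k. D (k *s v))) (at \<xi>)"
        by (rule has_derivative_compose[OF L D])
      then have "(g has_derivative (\<lambda>k. D (k *s v) $ i - (k *s v) $ i)) (at \<xi>)"
        unfolding g_def by (intro has_derivative_diff has_derivative_vec_nth L)
      moreover have "(\<lambda>k. D (k *s v) $ i - (k *s v) $ i) = (*) (D v $ i - v $ i)"
        by (auto simp: lin algebra_simps)
      ultimately show ?thesis by (auto simp: has_field_derivative_def)
    qed
    have bound: "cmod (g \<xi>) \<le> \<delta>" if "cmod \<xi> \<le> 1 + \<rho>" for \<xi>
      using close[OF inball[OF that]] Finite_Cartesian_Product.norm_nth_le[of "f (z + \<xi> *s v) - (z + \<xi> *s v)" i]
      by (simp add: g_def)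
    have "cmod (deriv g \<xi>) \<le> \<delta> / \<rho>" if "\<xi> \<in> cball 0 1" for \<xi>
    proof -
      have sub: "cmod x \<le> 1 + \<rho>" if "x \<in> cball \<xi> \<rho>" for x
        using that \<open>\<xi> \<in> cball 0 1\<close> norm_triangle_ineq2[of x \<xi>] by (simp add: dist_norm norm_minus_commute)
      have h: "g holomorphic_on cball \<xi> \<rho>"
        using der sub by (meson field_differentiable_at_within field_differentiable_def holomorphic_on_def)
      have "cmod ((deriv ^^ 1) g \<xi>) \<le> fact 1 * \<delta> / \<rho> ^ 1"
        using h \<rho>(1) sub bound
        by (intro Cauchy_inequality) (auto intro: holomorphic_on_subset holomorphic_on_imp_continuous_on
             simp: dist_norm)
      then show ?thesis by simp
    qed
    moreover have "(g has_field_derivative deriv g \<xi>) (at \<xi> within cball 0 1)" if "\<xi> \<in> cball 0 1" for \<xi>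
      using der[of \<xi>] that \<rho>(1)
      by (metis DERIV_deriv_iff_has_field_derivative has_field_derivative_at_within add_increasing2
          less_eq_real_def mem_cball_0)
    ultimately have "cmod (g 0 - g 1) \<le> \<delta> / \<rho> * cmod (0 - 1)"
      by (intro field_differentiable_bound[of "cball 0 1"]) auto
    moreover have "g 0 - g 1 = v $ i"
      using eq by (simp add: g_def v_def)
    ultimately show ?thesis by simp
  qed
  have "norm v \<le> (\<Sum>i\<in>UNIV. cmod (v $ i))"
    by (simp add: norm_vec_def L2_set_le_sum)
  also have "\<dots> \<le> (\<Sum>i\<in>(UNIV::'n set). \<delta> / \<rho>)"
    by (intro sum_mono comp)
  also have "\<dots> = 4 * real CARD('n) * \<delta> * norm v / r"
    by (simp add: \<rho>_def)
  also have "\<dots> < r * norm v / r"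
    using assms(3,4) v0 by (intro divide_strict_right_mono mult_strict_right_mono) auto
  finally show False using \<open>0 < r\<close> by simp
qed


section \<open>Charts as homeomorphisms\<close>

lemma chart_inv_left:
  assumes "is_chart X c" "q \<in> fst c"
  shows "chart_inv c (snd c q) = q"
  using assms unfolding is_chart_def chart_inv_def
  by (metis homeomorphic_eq_everything_map inv_into_f_f openin_subset topspace_subtopology_subset)

lemma chart_inv_right:
  assumes "z \<in> snd c ` fst c"
  shows "chart_inv c z \<in> fst c" "snd c (chart_inv c z) = z"
  using assms unfolding chart_inv_def by (auto intro: inv_into_into f_inv_into_f)

lemma chart_subset_topspace:
  assumes "is_chart X c"
  shows "fst c \<subseteq> topspace X"
  using assms unfolding is_chart_def by (auto dest: openin_subset)

lemma continuous_map_chart: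
  assumes "is_chart X c"
  shows "continuous_map (subtopology X (fst c)) euclidean (snd c)"
proof -
  have "continuous_map (subtopology X (fst c)) (top_of_set (snd c ` fst c)) (snd c)"
    using assms unfolding is_chart_def by (simp add: homeomorphic_imp_continuous_map)
  then show ?thesis
    by (simp add: continuous_map_in_subtopology)
qed

lemma openin_chart_preimage:
  assumes "is_chart X c" "open V"
  shows "openin X {q \<in> fst c. snd c q \<in> V}"
proof -
  have "openin (subtopology X (fst c)) {q \<in> topspace (subtopology X (fst c)). snd c q \<in> V}"
    using continuous_map_chart[OF assms(1)] assms(2)
    by (intro openin_continuous_map_preimage[where Y = euclidean]) auto
  moreover have "{q \<in> topspace (subtopology X (fst c)). snd c q \<in> V} = {q \<in> fst c. snd c q \<in> V}"
    using chart_subset_topspace[OF assms(1)] by auto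
  ultimately show ?thesis
    using assms(1) unfolding is_chart_def by (metis openin_trans_full)
qed

lemma open_chart_image:
  assumes "is_chart X c" "openin X U" "U \<subseteq> fst c"
  shows "open (snd c ` U)"
proof -
  have "openin (subtopology X (fst c)) U"
    using assms by (simp add: is_chart_def openin_open_subtopology)
  then have "openin (top_of_set (snd c ` fst c)) (snd c ` U)"
    using assms(1) unfolding is_chart_def
    by (metis homeomorphic_imp_open_map open_map_def)
  then show ?thesis
    using assms(1) unfolding is_chart_def by (meson openin_open_trans)
qed

lemma continuous_map_chart_inv:
  assumes "is_chart X c"
  shows "continuous_map (top_of_set (snd c ` fst c)) X (chart_inv c)"
  unfolding continuous_map_def
proof (intro conjI allI impI funcsetI)
  fix z assume "z \<in> topspace (top_of_set (snd c ` fst c))"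
  then show "chart_inv c z \<in> topspace X"
    using chart_inv_right(1)[of z c] chart_subset_topspace[OF assms] by auto
next
  fix U assume U: "openin X U"
  have "{z \<in> topspace (top_of_set (snd c ` fst c)). chart_inv c z \<in> U} = snd c ` (fst c \<inter> U)"
    using chart_inv_left[OF assms] by force
  moreover have "open (snd c ` (fst c \<inter> U))"
    using assms U by (intro open_chart_image[OF assms]) (auto simp: is_chart_def)
  ultimately show "openin (top_of_set (snd c ` fst c))
      {z \<in> topspace (top_of_set (snd c ` fst c)). chart_inv c z \<in> U}"
    by (simp add: open_subset image_mono)
qed

lemma compactin_chart_inv_image:
  assumes "is_chart X c" "compact K" "K \<subseteq> snd c ` fst c"
  shows "compactin X (chart_inv c ` K)"
  using assms by (intro image_compactin[OF _ continuous_map_chart_inv])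
    (auto simp: compactin_subtopology)

lemma chart_ball_exists:
  assumes "is_chart X c" "p \<in> fst c"
  obtains R where "0 < R" "cball (snd c p) R \<subseteq> snd c ` fst c"
  using assms unfolding is_chart_def by (meson imageI open_contains_cball)

section \<open>Tangent vectors in coordinates\<close>

lemma atlas_chart:
  assumes "complex_atlas X A" "c \<in> A"
  shows "is_chart X c"
  using assms unfolding complex_atlas_def by auto

lemma transition_apply:
  assumes "is_chart X c" "p \<in> fst c"
  shows "transition c d (snd c p) = snd d p"
  using assms by (simp add: transition_def chart_inv_left)

lemma transition_has_derivative:
  assumes "complex_atlas X A" "c \<in> A" "d \<in> A" "p \<in> fst c \<inter> fst d"
  shows "(transition c d has_derivative frechet_derivative (transition c d) (at (snd c p))) (at (snd c p))"
    and "frechet_derivative (transition c d) (at (snd c p)) (a *s x)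
          = a *s frechet_derivative (transition c d) (at (snd c p)) x"
proof -
  obtain D where D: "(transition c d has_derivative D) (at (snd c p))"
    and lin: "\<And>a x. D (a *s x) = a *s D x"
    using assms unfolding complex_atlas_def vec_holomorphic_on_def by blast
  have eq: "frechet_derivative (transition c d) (at (snd c p)) = D"
    using frechet_derivative_at[OF D] by simp
  show "(transition c d has_derivative frechet_derivative (transition c d) (at (snd c p))) (at (snd c p))"
    "frechet_derivative (transition c d) (at (snd c p)) (a *s x)
          = a *s frechet_derivative (transition c d) (at (snd c p)) x"
    using D lin eq by auto
qed

text \<open>The chain rule for \<open>transition c e = transition d e \<circ> transition c d\<close>, which holds near
  \<open>snd c p\<close> only.\<close>

lemma transition_cocycle:
  assumes at: "complex_atlas X A" and cde: "c \<in> A" "d \<in> A" "e \<in> A"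
    and p: "p \<in> fst c" "p \<in> fst d" "p \<in> fst e"
  shows "frechet_derivative (transition c e) (at (snd c p)) x
    = frechet_derivative (transition d e) (at (snd d p))
        (frechet_derivative (transition c d) (at (snd c p)) x)"
proof -
  note ch = atlas_chart[OF at cde(1)] atlas_chart[OF at cde(2)] atlas_chart[OF at cde(3)]
  have op: "open (snd c ` (fst c \<inter> fst d \<inter> fst e))"
    using ch by (intro open_chart_image[OF ch(1)]) (auto simp: is_chart_def)
  have "((\<lambda>z. transition d e (transition c d z)) has_derivative
      (\<lambda>x. frechet_derivative (transition d e) (at (snd d p))
        (frechet_derivative (transition c d) (at (snd c p)) x))) (at (snd c p))"
    by (rule has_derivative_compose[where f = "transition c d"])
      (use p transition_has_derivative(1)[OF at cde(1,2), of p]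
        transition_has_derivative(1)[OF at cde(2,3), of p]
       in \<open>simp_all add: transition_apply[OF ch(1) p(1)]\<close>)
  then have "(transition c e has_derivative
      (\<lambda>x. frechet_derivative (transition d e) (at (snd d p))
        (frechet_derivative (transition c d) (at (snd c p)) x))) (at (snd c p))"
    by (rule has_derivative_transform_within_open[OF _ op]) (use p ch in \<open>auto simp: transition_apply\<close>)
  from frechet_derivative_at[OF this] show ?thesis by (metis (no_types))
qed

lemma transition_self_derivative:
  assumes "is_chart X c" "p \<in> fst c"
  shows "frechet_derivative (transition c c) (at (snd c p)) x = x"
proof -
  have "(transition c c has_derivative (\<lambda>x. x)) (at (snd c p))"
    by (rule has_derivative_transform_within_open[OF has_derivative_ident, of "snd c ` fst c"])
      (use assms in \<open>auto simp: transition_apply[OF assms(1)] is_chart_def\<close>)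
  from frechet_derivative_at[OF this] show ?thesis by (metis (no_types))
qed

lemma tvec_of_coords_in_tangent_space:
  assumes "complex_atlas X A" "c \<in> A" "p \<in> fst c"
  shows "tvec_of_coords A c p x \<in> tangent_space A p"
  unfolding tangent_space_def tvec_of_coords_def
proof (intro CollectI conjI allI ballI impI)
  fix d e assume de: "d \<in> A" "e \<in> A" "p \<in> fst d \<inter> fst e"
  then have mem: "d \<in> A \<and> p \<in> fst d" "e \<in> A \<and> p \<in> fst e" by auto
  show "(if e \<in> A \<and> p \<in> fst e then frechet_derivative (transition c e) (at (snd c p)) x else 0)
    = frechet_derivative (transition d e) (at (snd d p))
        (if d \<in> A \<and> p \<in> fst d then frechet_derivative (transition c d) (at (snd c p)) x else 0)"
    unfolding if_P[OF mem(1)] if_P[OF mem(2)]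
    by (rule transition_cocycle[OF assms(1,2) _ _ assms(3)]) (use de in auto)
qed auto

lemma tvec_of_coords_add:
  assumes "complex_atlas X A" "c \<in> A" "p \<in> fst c"
  shows "tvec_of_coords A c p (x + y) = (\<lambda>d. tvec_of_coords A c p x d + tvec_of_coords A c p y d)"
  using assms transition_has_derivative(1)[OF assms(1,2), THEN has_derivative_linear]
  unfolding tvec_of_coords_def by (auto simp: linear_add)

lemma tvec_of_coords_scale:
  assumes "complex_atlas X A" "c \<in> A" "p \<in> fst c"
  shows "tvec_of_coords A c p (a *s x) = (\<lambda>d. a *s tvec_of_coords A c p x d)"
  using assms transition_has_derivative(2)[OF assms(1,2)]
  unfolding tvec_of_coords_def by auto

lemma tvec_of_coords_nonzero:
  assumes "complex_atlas X A" "c \<in> A" "p \<in> fst c" "x \<noteq> 0"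
  shows "tvec_of_coords A c p x \<noteq> (\<lambda>d. 0)"
proof
  assume "tvec_of_coords A c p x = (\<lambda>d. 0)"
  from fun_cong[OF this, of c] show False
    using assms transition_self_derivative[OF atlas_chart[OF assms(1,2)] assms(3)]
    by (simp add: tvec_of_coords_def)
qed

text \<open>Differentiability of the curve in the single chart \<open>c\<close> suffices: in any other chart around
  \<open>\<gamma> t\<close> the coordinates of the curve are, for nearby times, those in \<open>c\<close> followed by a transition
  map, and the chain rule applies.\<close>

lemma velocity_eq_tvec_of_coords:
  assumes at: "complex_atlas X A" and c: "c \<in> A"
    and cont: "continuous_map (top_of_set {0..1}) X \<gamma>"
    and T: "open T" "T \<subseteq> {0..1}" "t \<in> T" "\<gamma> ` T \<subseteq> fst c"
    and diff: "(snd c \<circ> \<gamma>) differentiable (at t)"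
  shows "velocity A \<gamma> t = tvec_of_coords A c (\<gamma> t) (vector_derivative (snd c \<circ> \<gamma>) (at t))"
proof
  fix d
  show "velocity A \<gamma> t d = tvec_of_coords A c (\<gamma> t) (vector_derivative (snd c \<circ> \<gamma>) (at t)) d"
  proof (cases "d \<in> A \<and> \<gamma> t \<in> fst d")
    case True
    note ch = atlas_chart[OF at c]
    have "openin (top_of_set {0..1}) {s \<in> topspace (top_of_set {0..1}). \<gamma> s \<in> fst d}"
      using cont True atlas_chart[OF at, of d]
      by (intro openin_continuous_map_preimage) (auto simp: is_chart_def)
    then obtain W where W: "open W" "{s \<in> {0..1}. \<gamma> s \<in> fst d} = {0..1} \<inter> W"
      by (auto simp: openin_open)
    let ?w = "vector_derivative (snd c \<circ> \<gamma>) (at t)"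
    have D: "(transition c d has_derivative frechet_derivative (transition c d) (at (snd c (\<gamma> t))))
        (at ((snd c \<circ> \<gamma>) t))"
      using transition_has_derivative(1)[OF at c, of d "\<gamma> t"] True T by (simp add: image_subset_iff)
    have "((snd c \<circ> \<gamma>) has_derivative (\<lambda>k. k *\<^sub>R ?w)) (at t)"
      using diff vector_derivative_works has_vector_derivative_def by blast
    from has_derivative_compose[OF this D]
    have "((\<lambda>s. transition c d (snd c (\<gamma> s))) has_derivative
        (\<lambda>k. k *\<^sub>R frechet_derivative (transition c d) (at (snd c (\<gamma> t))) ?w)) (at t)"
      using linear_cmul[OF has_derivative_linear[OF D]] by simp
    then have "((snd d \<circ> \<gamma>) has_derivative
        (\<lambda>k. k *\<^sub>R frechet_derivative (transition c d) (at (snd c (\<gamma> t))) ?w)) (at t)"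
    proof (rule has_derivative_transform_within_open[where s = "T \<inter> W"])
      show "t \<in> T \<inter> W" using T W True by blast
    qed (use T W in \<open>auto simp: transition_apply[OF ch] image_subset_iff\<close>)
    then have "vector_derivative (snd d \<circ> \<gamma>) (at t)
        = frechet_derivative (transition c d) (at (snd c (\<gamma> t))) ?w"
      by (intro vector_derivative_at) (simp add: has_vector_derivative_def)
    with True show ?thesis by (simp add: velocity_def tvec_of_coords_def)
  qed (auto simp: velocity_def tvec_of_coords_def)
qed

section \<open>Comparison of the metric with the Euclidean norm\<close>

text \<open>Expanding in the standard basis shows that the squared length of a coordinate vector depends
  continuously on the base point and the vector together, although the smoothness of the metric is
  given one pair of vectors at a time. It therefore attains a positive minimum \<open>\<mu>\<close> over \<open>K\<close> times
  the unit sphere, and homogeneity extends the bound to all vectors.\<close>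

lemma hermitian_metric_lower_bound:
  fixes A :: "('a, 'n::finite) chart set"
  assumes at: "complex_atlas X A" and herm: "hermitian_metric X A h" and c: "c \<in> A"
    and K: "compact K" "K \<subseteq> snd c ` fst c"
  obtains m where "0 < m"
    "\<And>q x. q \<in> fst c \<Longrightarrow> snd c q \<in> K \<Longrightarrow>
       m * norm x \<le> sqrt (Re (h q (tvec_of_coords A c q x) (tvec_of_coords A c q x)))"
proof -
  note ch = atlas_chart[OF at c]
  define H where "H = (\<lambda>z x y. h (chart_inv c z) (tvec_of_coords A c (chart_inv c z) x)
                                  (tvec_of_coords A c (chart_inv c z) y))"
  have H: "H z (x + y) w = H z x w + H z y w" "H z (a *s x) w = a * H z x w"
    "H z x w = cnj (H z w x)" "x \<noteq> 0 \<Longrightarrow> 0 < Re (H z x x)"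
    if "z \<in> snd c ` fst c" for z x y w a
  proof -
    have p: "chart_inv c z \<in> fst c" "chart_inv c z \<in> topspace X"
      using chart_inv_right[OF that] chart_subset_topspace[OF ch] by auto
    note tv = tvec_of_coords_in_tangent_space[OF at c p(1)]
    show "H z (x + y) w = H z x w + H z y w"
      using herm p(2) tv unfolding H_def tvec_of_coords_add[OF at c p(1)] hermitian_metric_def by blast
    show "H z (a *s x) w = a * H z x w"
      using herm p(2) tv unfolding H_def tvec_of_coords_scale[OF at c p(1)] hermitian_metric_def by blast
    show "H z x w = cnj (H z w x)"
      using herm p(2) tv unfolding H_def hermitian_metric_def by blast
    show "0 < Re (H z x x)" if "x \<noteq> 0"
      using herm p(2) tv tvec_of_coords_nonzero[OF at c p(1) that]
      unfolding H_def hermitian_metric_def by blast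
  qed
  have H0: "H z 0 w = 0" if "z \<in> snd c ` fst c" for z w
    using H(2)[OF that, of 0 0 w] by simp
  have Hsum: "H z (\<Sum>i\<in>S. f i) w = (\<Sum>i\<in>S. H z (f i) w)"
    if "z \<in> snd c ` fst c" "finite S" for z w S and f :: "'n \<Rightarrow> complex^'n"
    using that(2) by (induction S rule: finite_induct) (simp_all add: H0 H(1) that(1))
  have expand: "H z x w = (\<Sum>i\<in>UNIV. x $ i * H z (axis i 1) w)" if "z \<in> snd c ` fst c" for z x w
    using Hsum[OF that, of UNIV "\<lambda>i. x $ i *s axis i 1" w] H(2)[OF that]
    by (simp add: basis_expansion)
  \<comment> \<open>\<open>Q\<close> is the squared length written through the coefficients of the metric, which exhibits its
    joint continuity.\<close>
  define Q where "Q = (\<lambda>(z, x). Re (\<Sum>i\<in>UNIV. x $ i * cnj (\<Sum>j\<in>UNIV. x $ j * H z (axis j 1) (axis i 1))))"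
  have Q: "Re (H z x x) = Q (z, x)" if "z \<in> snd c ` fst c" for z x
    unfolding Q_def case_prod_conv expand[OF that, of x "axis _ 1", symmetric]
    by (subst expand[OF that]) (simp add: H(3)[OF that, symmetric])
  have contH: "continuous_on K (\<lambda>z. H z (axis j 1) (axis i 1))" for i j
  proof -
    have "smooth_on (\<lambda>z. H z (axis j 1) (axis i 1)) (snd c ` fst c)"
      using herm c unfolding hermitian_metric_def H_def Let_def by blast
    then have "Ck_on 0 (\<lambda>z. H z (axis j 1) (axis i 1)) (snd c ` fst c)"
      unfolding smooth_on_def by blast
    then show ?thesis using K(2) by (auto intro: continuous_on_subset)
  qed
  have contQ: "continuous_on (K \<times> sphere 0 1) Q"
    unfolding Q_def case_prod_unfold
    by (intro continuous_intros continuous_on_compose2[OF contH]) auto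
  have "\<exists>\<mu>>0. \<forall>z\<in>K. \<forall>x\<in>sphere 0 1. \<mu> \<le> Q (z, x)"
  proof (cases "K = {}")
    case False
    have "compact (K \<times> sphere (0::complex^'n) 1)"
      using K by (intro compact_Times) auto
    moreover have "K \<times> sphere (0::complex^'n) 1 \<noteq> {}"
      using False by (auto intro!: exI[of _ "axis undefined 1"])
    ultimately obtain y where y: "y \<in> K \<times> sphere 0 1" "\<forall>x\<in>K \<times> sphere 0 1. Q y \<le> Q x"
      using continuous_attains_inf[OF _ _ contQ] by auto
    obtain z x where zx: "y = (z, x)" "z \<in> K" "norm x = 1" using y(1) by auto
    then have "x \<noteq> 0" by auto
    then have "0 < Q y" using H(4) Q zx K(2) by (metis subsetD)
    with y(2) show ?thesis by auto
  qed (auto intro: exI[of _ 1])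
  then obtain \<mu> where \<mu>: "0 < \<mu>" "\<And>z x. z \<in> K \<Longrightarrow> norm x = 1 \<Longrightarrow> \<mu> \<le> Q (z, x)" by auto
  show thesis
  proof
    show "0 < sqrt \<mu>" using \<mu> by simp
    fix q and x :: "complex^'n"
    assume q: "q \<in> fst c" "snd c q \<in> K"
    let ?z = "snd c q"
    have z: "?z \<in> snd c ` fst c" using q by simp
    have inv: "chart_inv c ?z = q" using chart_inv_left[OF ch q(1)] .
    have "\<mu> * (norm x)\<^sup>2 \<le> Re (H ?z x x)"
    proof (cases "x = 0")
      case False
      define u where "u = complex_of_real (1 / norm x) *s x"
      have nu: "norm u = 1" using False unfolding u_def norm_scale_vec norm_of_real by simp
      have xu: "x = complex_of_real (norm x) *s u"
        using False by (simp add: u_def vec_eq_iff)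
      have "H ?z (a *s u) (a *s u) = a * cnj a * H ?z u u" for a
        unfolding H(2)[OF z] H(3)[OF z, of u "a *s u"] complex_cnj_mult
        by (simp add: H(3)[OF z, of u u, symmetric])
      from this[of "complex_of_real (norm x)"]
      have "Re (H ?z x x) = (norm x)\<^sup>2 * Re (H ?z u u)"
        unfolding xu[symmetric] by (simp add: power2_eq_square)
      also have "\<dots> \<ge> (norm x)\<^sup>2 * \<mu>"
        using \<mu>(2)[OF q(2) nu] Q[OF z] by (intro mult_left_mono) auto
      finally show ?thesis by (simp add: mult.commute)
    qed (simp add: H0[OF z])
    then have "sqrt (\<mu> * (norm x)\<^sup>2) \<le> sqrt (Re (H ?z x x))"
      by (rule real_sqrt_le_mono)
    then show "sqrt \<mu> * norm x \<le> sqrt (Re (h q (tvec_of_coords A c q x) (tvec_of_coords A c q x)))"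
      by (simp add: real_sqrt_mult H_def inv)
  qed
qed

section \<open>The induced distance controls coordinates\<close>

text \<open>The speed may be unbounded near the break points. If its integral is infinite there is nothing
  to prove; if it is finite, the velocity is Lebesgue integrable and its integral is the
  displacement. The factor \<open>m\<close> sits inside the integral so that the bound can be compared with an
  integrand that is not known to be measurable.\<close>

lemma norm_displacement_le_nn_integral_speed:
  fixes F :: "real \<Rightarrow> 'e::euclidean_space"
  assumes "a \<le> b" "F piecewise_C1_differentiable_on {a..b}" "0 \<le> m"
  shows "ennreal (m * norm (F b - F a))
    \<le> (\<integral>\<^sup>+ t\<in>{a..b}. ennreal (m * norm (vector_derivative F (at t))) \<partial>lborel)"
proof -
  let ?g = "\<lambda>t. vector_derivative F (at t)"
  let ?I = "\<integral>\<^sup>+ t. ennreal (norm (?g t)) \<partial>lebesgue_on {a..b}"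
  obtain S where S: "finite S" "continuous_on {a..b} F" "F C1_differentiable_on ({a..b} - S)"
    using assms(2) unfolding piecewise_C1_differentiable_on_def by auto
  have "(F has_vector_derivative ?g t) (at t)" if "t \<in> {a<..<b} - S" for t
    using S(3) that unfolding C1_differentiable_on_eq
    by (auto simp: vector_derivative_works)
  then have hi: "(?g has_integral (F b - F a)) {a..b}"
    using S assms(1) by (intro fundamental_theorem_of_calculus_interior_strong) auto
  then have meas: "?g \<in> borel_measurable (lebesgue_on {a..b})"
    by (intro integrable_imp_measurable) auto
  have "ennreal (norm (F b - F a)) \<le> ?I"
  proof (cases "?I = \<infinity>")
    case False
    then have int: "integrable (lebesgue_on {a..b}) ?g"
      using meas by (intro integrableI_bounded) (auto simp: less_top)
    then have "integral\<^sup>L (lebesgue_on {a..b}) ?g = F b - F a"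
      using hi lebesgue_integral_eq_integral[of "{a..b}" ?g] by (simp add: integral_unique)
    then show ?thesis
      using integral_norm_bound_ennreal[OF int] by simp
  qed simp
  then have "ennreal (m * norm (F b - F a)) \<le> ennreal m * ?I"
    using assms(3) by (simp add: ennreal_mult mult_left_mono)
  also have "\<dots> = (\<integral>\<^sup>+ t. ennreal (m * norm (?g t)) \<partial>lebesgue_on {a..b})"
    using meas assms(3) by (subst nn_integral_cmult[symmetric]) (auto simp: ennreal_mult)
  also have "\<dots> = (\<integral>\<^sup>+ t\<in>{a..b}. ennreal (m * norm (?g t)) \<partial>lborel)"
    by (simp add: nn_integral_restrict_space nn_integral_completion)
  finally show ?thesis .
qed

lemma chart_displacement_le_curve_length:
  assumes at: "complex_atlas X A" and c: "c \<in> A"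
    and curve: "piecewise_C1_curve X A \<gamma>" and \<tau>: "0 \<le> \<tau>" "\<tau> \<le> 1"
    and inK: "\<And>t. t \<in> {0..\<tau>} \<Longrightarrow> \<gamma> t \<in> fst c \<and> snd c (\<gamma> t) \<in> K"
    and m: "0 \<le> m" "\<And>q x. q \<in> fst c \<Longrightarrow> snd c q \<in> K \<Longrightarrow>
       m * norm x \<le> sqrt (Re (h q (tvec_of_coords A c q x) (tvec_of_coords A c q x)))"
  shows "ennreal (m * norm (snd c (\<gamma> \<tau>) - snd c (\<gamma> 0))) \<le> curve_length A h \<gamma>"
proof -
  let ?F = "snd c \<circ> \<gamma>"
  have F: "?F piecewise_C1_differentiable_on {0..\<tau>}"
    using curve c \<tau> inK unfolding piecewise_C1_curve_def by (auto simp: image_subset_iff)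
  have cont: "continuous_map (top_of_set {0..1}) X \<gamma>"
    using curve unfolding piecewise_C1_curve_def by auto
  obtain S where S: "finite S" "\<And>t. t \<in> {0..\<tau>} - S \<Longrightarrow> ?F differentiable (at t)"
    using F unfolding piecewise_C1_differentiable_on_def C1_differentiable_on_eq by auto
  have "ennreal (m * norm (?F \<tau> - ?F 0))
      \<le> (\<integral>\<^sup>+ t\<in>{0..\<tau>}. ennreal (m * norm (vector_derivative ?F (at t))) \<partial>lborel)"
    by (rule norm_displacement_le_nn_integral_speed[OF \<tau>(1) F m(1)])
  also have "\<dots> \<le> curve_length A h \<gamma>"
    unfolding curve_length_def
  proof (rule nn_integral_mono_AE)
    have "S \<union> {0, \<tau>} \<in> null_sets lborel"
      using S(1) by (intro finite_imp_null_set_lborel) auto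
    then have "AE t in lborel. t \<notin> S \<union> {0, \<tau>}"
      by (rule AE_not_in)
    then show "AE t in lborel.
        ennreal (m * norm (vector_derivative ?F (at t))) * indicator {0..\<tau>} t
        \<le> ennreal (sqrt (Re (h (\<gamma> t) (velocity A \<gamma> t) (velocity A \<gamma> t)))) * indicator {0..1} t"
    proof (rule AE_mp, intro AE_I2 impI)
      fix t assume t: "t \<notin> S \<union> {0, \<tau>}"
      show "ennreal (m * norm (vector_derivative ?F (at t))) * indicator {0..\<tau>} t
        \<le> ennreal (sqrt (Re (h (\<gamma> t) (velocity A \<gamma> t) (velocity A \<gamma> t)))) * indicator {0..1} t"
      proof (cases "t \<in> {0..\<tau>}")
        case True
        with t have t': "t \<in> {0<..<\<tau>}" by auto
        have "velocity A \<gamma> t = tvec_of_coords A c (\<gamma> t) (vector_derivative ?F (at t))"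
        proof (rule velocity_eq_tvec_of_coords[OF at c cont open_greaterThanLessThan _ t'])
          show "{0<..<\<tau>} \<subseteq> {0..1}" using \<tau> by auto
          show "\<gamma> ` {0<..<\<tau>} \<subseteq> fst c" using inK by auto
          show "?F differentiable at t" using S(2)[of t] True t by blast
        qed
        then have "m * norm (vector_derivative ?F (at t))
            \<le> sqrt (Re (h (\<gamma> t) (velocity A \<gamma> t) (velocity A \<gamma> t)))"
          using m(2) inK[OF True] by simp
        then show ?thesis using True \<tau> by (simp add: ennreal_leI)
      qed simp
    qed
  qed
  finally show ?thesis by simp
qed

text \<open>A continuity argument: at the first time at which the curve could leave the open ball it is
  still in the closed one, whose preimage in the manifold is compact, hence closed. Up to that
  time the metric bound applies, and the length is too small for the curve to have reached the
  sphere of radius \<open>R\<close>.\<close>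

lemma short_curve_stays_in_chart:
  assumes H: "Hausdorff_space X" and at: "complex_atlas X A" and c: "c \<in> A"
    and ball: "cball x0 R \<subseteq> snd c ` fst c"
    and curve: "piecewise_C1_curve X A \<gamma>" and start: "\<gamma> 0 \<in> fst c"
    and \<delta>: "0 < \<delta>" "dist x0 (snd c (\<gamma> 0)) + \<delta> \<le> R"
    and m: "0 < m" "\<And>q x. q \<in> fst c \<Longrightarrow> snd c q \<in> cball x0 R \<Longrightarrow>
       m * norm x \<le> sqrt (Re (h q (tvec_of_coords A c q x) (tvec_of_coords A c q x)))"
    and short: "curve_length A h \<gamma> < ennreal (m * \<delta>)"
  shows "\<gamma> 1 \<in> fst c \<and> norm (snd c (\<gamma> 1) - snd c (\<gamma> 0)) < \<delta>"
proof -
  note ch = atlas_chart[OF at c]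
  have cont: "continuous_map (top_of_set {0..1}) X \<gamma>"
    using curve unfolding piecewise_C1_curve_def by auto
  define U where "U = {q \<in> fst c. snd c q \<in> ball x0 R}"
  define C where "C = {q \<in> fst c. snd c q \<in> cball x0 R}"
  have "C = chart_inv c ` cball x0 R"
  proof (intro equalityI subsetI)
    fix q assume "q \<in> C"
    then show "q \<in> chart_inv c ` cball x0 R"
      unfolding C_def using chart_inv_left[OF ch] by (metis (mono_tags, lifting) imageI mem_Collect_eq)
  next
    fix q assume "q \<in> chart_inv c ` cball x0 R"
    then show "q \<in> C"
      unfolding C_def using chart_inv_right ball by (smt (verit, best) image_iff mem_Collect_eq subsetD)
  qed
  then have closedC: "closedin X C"
    using compactin_chart_inv_image[OF ch _ ball] H by (simp add: compactin_imp_closedin)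
  have openU: "openin X U"
    unfolding U_def by (rule openin_chart_preimage[OF ch open_ball])
  have move: "norm (snd c (\<gamma> \<tau>) - snd c (\<gamma> 0)) < \<delta> \<and> \<gamma> \<tau> \<in> U"
    if \<tau>: "\<tau> \<in> {0..1}" and inC: "\<And>t. t \<in> {0..\<tau>} \<Longrightarrow> \<gamma> t \<in> C" for \<tau>
  proof -
    have "ennreal (m * norm (snd c (\<gamma> \<tau>) - snd c (\<gamma> 0))) \<le> curve_length A h \<gamma>"
      using \<tau> inC m
      by (intro chart_displacement_le_curve_length[OF at c curve, where K = "cball x0 R"])
        (auto simp: C_def)
    also note short
    finally have lt: "norm (snd c (\<gamma> \<tau>) - snd c (\<gamma> 0)) < \<delta>"
      using m(1) by (simp add: ennreal_less_iff)
    moreover have "dist x0 (snd c (\<gamma> \<tau>)) \<le> dist x0 (snd c (\<gamma> 0)) + dist (snd c (\<gamma> 0)) (snd c (\<gamma> \<tau>))"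
      by (rule dist_triangle)
    ultimately have "dist x0 (snd c (\<gamma> \<tau>)) < R"
      using \<delta> by (simp add: dist_norm norm_minus_commute)
    then show ?thesis using lt inC[of \<tau>] \<tau> by (auto simp: U_def C_def)
  qed
  define B where "B = {t \<in> {0..1}. \<gamma> t \<notin> U}"
  have "B = {}"
  proof (rule ccontr)
    assume "B \<noteq> {}"
    have "closedin (top_of_set {0..1}) {t \<in> topspace (top_of_set {0..1}). \<gamma> t \<in> topspace X - U}"
      using openU by (intro closedin_continuous_map_preimage[OF cont]) auto
    moreover have "{t \<in> topspace (top_of_set {0..1}). \<gamma> t \<in> topspace X - U} = B"
      using cont by (auto simp: B_def continuous_map_def)
    ultimately have "compact B"
      by (metis closedin_compact compact_Icc)
    then obtain \<tau> where \<tau>: "\<tau> \<in> B" "\<And>t. t \<in> B \<Longrightarrow> \<tau> \<le> t"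
      using \<open>B \<noteq> {}\<close> compact_attains_inf by metis
    have \<tau>01: "\<tau> \<in> {0..1}" using \<tau> by (simp add: B_def)
    have before: "\<gamma> t \<in> C" if "0 \<le> t" "t < \<tau>" for t
      using \<tau>(2)[of t] that \<tau>01 by (fastforce simp: B_def U_def C_def)
    have "\<gamma> 0 \<in> U" using start \<delta> by (simp add: U_def)
    then have "0 < \<tau>" using \<tau>(1) by (cases "\<tau> = 0") (auto simp: B_def)
    have "closedin (top_of_set {0..1}) {t \<in> topspace (top_of_set {0..1}). \<gamma> t \<in> C}"
      using closedC by (intro closedin_continuous_map_preimage[OF cont])
    then have "closed {t \<in> {0..1}. \<gamma> t \<in> C}"
      using closedin_closed_trans by fastforce
    moreover have "{0..<\<tau>} \<subseteq> {t \<in> {0..1}. \<gamma> t \<in> C}"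
      using before \<tau>01 by auto
    ultimately have "closure {0..<\<tau>} \<subseteq> {t \<in> {0..1}. \<gamma> t \<in> C}"
      by (rule closure_minimal[rotated])
    then have "{0..\<tau>} \<subseteq> {t \<in> {0..1}. \<gamma> t \<in> C}" using \<open>0 < \<tau>\<close> by simp
    then have "\<gamma> \<tau> \<in> C" using \<open>0 < \<tau>\<close> by (simp add: subset_iff)
    then have "\<gamma> t \<in> C" if "t \<in> {0..\<tau>}" for t
      using before[of t] that by (cases "t = \<tau>") auto
    then have "\<gamma> \<tau> \<in> U" using move[OF \<tau>01] by blast
    then show False using \<tau>(1) by (simp add: B_def)
  qed
  then have "\<gamma> t \<in> U" if "t \<in> {0..1}" for t
    using that by (auto simp: B_def)
  then show ?thesis
    using move[of 1] by (auto simp: U_def C_def less_imp_le)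
qed

lemma manifold_dist_controls_chart:
  fixes A :: "('a, 'n::finite) chart set"
  assumes man: "complex_manifold X A" and herm: "hermitian_metric X A h" and c: "c \<in> A"
    and ball: "cball x0 R \<subseteq> snd c ` fst c"
  obtains m where "0 < m"
    "\<And>q q' \<delta>. q \<in> fst c \<Longrightarrow> 0 < \<delta> \<Longrightarrow> dist x0 (snd c q) + \<delta> \<le> R \<Longrightarrow>
       manifold_dist X A h q q' < ennreal (m * \<delta>) \<Longrightarrow>
       q' \<in> fst c \<and> norm (snd c q' - snd c q) < \<delta>"
proof -
  have at: "complex_atlas X A" and H: "Hausdorff_space X"
    using man unfolding complex_manifold_def by auto
  obtain m where m: "0 < m" "\<And>q x. q \<in> fst c \<Longrightarrow> snd c q \<in> cball x0 R \<Longrightarrow>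
       m * norm x \<le> sqrt (Re (h q (tvec_of_coords A c q x) (tvec_of_coords A c q x)))"
    using hermitian_metric_lower_bound[OF at herm c compact_cball ball] by blast
  show thesis
  proof (rule that[OF m(1)])
    fix q q' \<delta>
    assume q: "q \<in> fst c" "0 < \<delta>" "dist x0 (snd c q) + \<delta> \<le> R"
      and "manifold_dist X A h q q' < ennreal (m * \<delta>)"
    then obtain \<gamma> where \<gamma>: "piecewise_C1_curve X A \<gamma>" "\<gamma> 0 = q" "\<gamma> 1 = q'"
      and short: "curve_length A h \<gamma> < ennreal (m * \<delta>)"
      unfolding manifold_dist_def INF_less_iff by auto
    show "q' \<in> fst c \<and> norm (snd c q' - snd c q) < \<delta>"
      using short_curve_stays_in_chart[OF H at c ball \<gamma>(1) _ q(2) _ m short] q \<gamma> by simp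
  qed
qed

section \<open>Evolution families\<close>

lemma evolution_family_lipschitz:
  assumes ev: "evolution_family X A h \<phi>" and "0 < T" "compactin X K"
  obtains C where "0 < C"
    "\<And>s t t' z. 0 \<le> s \<Longrightarrow> t \<in> {s..T} \<Longrightarrow> t' \<in> {s..T} \<Longrightarrow> z \<in> K \<Longrightarrow>
       manifold_dist X A h (\<phi> s t z) (\<phi> s t' z) \<le> ennreal (C * \<bar>t - t'\<bar>)"
proof -
  obtain C where C: "0 < C" "\<forall>s\<ge>0. \<forall>t\<in>{s..T}. \<forall>t'\<in>{s..T}.
      (SUP z\<in>K. manifold_dist X A h (\<phi> s t z) (\<phi> s t' z)) \<le> ennreal (C * \<bar>t - t'\<bar>)"
    using assms unfolding evolution_family_def by meson
  show thesis
    by (rule that[OF C(1)]) (use C(2) in \<open>auto simp: SUP_le_iff\<close>)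
qed

lemma evolution_family_id:
  assumes "evolution_family X A h \<phi>" "0 \<le> s" "z \<in> topspace X"
  shows "\<phi> s s z = z"
  using assms unfolding evolution_family_def by simp

lemma evolution_family_compose:
  assumes "evolution_family X A h \<phi>" "0 \<le> s" "s \<le> u" "u \<le> t" "z \<in> topspace X"
  shows "\<phi> u t (\<phi> s u z) = \<phi> s t z"
  using assms unfolding evolution_family_def by simp

lemma evolution_family_holomorphic:
  assumes "evolution_family X A h \<phi>" "0 \<le> s" "s \<le> t"
  shows "holomorphic_map X A X A (\<phi> s t)"
  using assms unfolding evolution_family_def by simp

lemma evolution_family_maps:
  assumes "evolution_family X A h \<phi>" "0 \<le> s" "s \<le> t" "z \<in> topspace X"
  shows "\<phi> s t z \<in> topspace X"
  using evolution_family_holomorphic[OF assms(1-3)] assms(4)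
  unfolding holomorphic_map_def continuous_map_def by auto

lemma atlas_covers:
  assumes "complex_atlas X A" "p \<in> topspace X"
  obtains c where "c \<in> A" "p \<in> fst c"
proof -
  have "p \<in> (\<Union>c\<in>A. fst c)"
    using assms unfolding complex_atlas_def by simp
  then show thesis using that by (elim UN_E)
qed

text \<open>The Lipschitz condition for a single starting point, transferred to a chart around the current
  position.\<close>

lemma trajectory_continuous:
  fixes A :: "('a, 'n::finite) chart set"
  assumes man: "complex_manifold X A" and herm: "hermitian_metric X A h"
    and ev: "evolution_family X A h \<phi>"
    and s: "0 \<le> s" and z: "z \<in> topspace X"
  shows "continuous_map (top_of_set {s..t}) X (\<lambda>u. \<phi> s u z)"
  unfolding continuous_map_def
proof (intro conjI allI impI funcsetI)
  fix u assume "u \<in> topspace (top_of_set {s..t})"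
  then show "\<phi> s u z \<in> topspace X"
    using evolution_family_maps[OF ev s _ z] by simp
next
  have at: "complex_atlas X A" using man unfolding complex_manifold_def by auto
  fix U assume U: "openin X U"
  show "openin (top_of_set {s..t}) {u \<in> topspace (top_of_set {s..t}). \<phi> s u z \<in> U}"
    unfolding openin_euclidean_subtopology_iff
  proof (intro conjI ballI)
    fix v assume "v \<in> {u \<in> topspace (top_of_set {s..t}). \<phi> s u z \<in> U}"
    then have v: "v \<in> {s..t}" "\<phi> s v z \<in> U" by auto
    define q where "q = \<phi> s v z"
    obtain c where c: "c \<in> A" "q \<in> fst c"
      using atlas_covers[OF at evolution_family_maps[OF ev s _ z]] v by (auto simp: q_def)
    note ch = atlas_chart[OF at c(1)]
    have "open (snd c ` (fst c \<inter> U))"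
      using ch U by (intro open_chart_image[OF ch]) (auto simp: is_chart_def)
    then obtain R where R: "0 < R" "cball (snd c q) R \<subseteq> snd c ` (fst c \<inter> U)"
      using c v unfolding open_contains_cball by (metis Int_iff imageI q_def)
    obtain m where m: "0 < m"
      "\<And>q' \<delta>. 0 < \<delta> \<Longrightarrow> \<delta> \<le> R \<Longrightarrow> manifold_dist X A h q q' < ennreal (m * \<delta>) \<Longrightarrow>
       q' \<in> fst c \<and> norm (snd c q' - snd c q) < \<delta>"
    proof -
      have "cball (snd c q) R \<subseteq> snd c ` fst c" using R(2) by blast
      from manifold_dist_controls_chart[OF man herm c(1) this] obtain m where m: "0 < m"
        "\<And>q1 q' \<delta>. q1 \<in> fst c \<Longrightarrow> 0 < \<delta> \<Longrightarrow> dist (snd c q) (snd c q1) + \<delta> \<le> R \<Longrightarrow>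
           manifold_dist X A h q1 q' < ennreal (m * \<delta>) \<Longrightarrow>
           q' \<in> fst c \<and> norm (snd c q' - snd c q1) < \<delta>"
        by blast
      show thesis
        by (rule that[OF m(1)]) (use m(2)[OF c(2)] in simp)
    qed
    have "0 < t + 1" "compactin X {z}" using v s z by auto
    from evolution_family_lipschitz[OF ev this] obtain C where C: "0 < C"
      "\<And>s t' t'' z'. 0 \<le> s \<Longrightarrow> t' \<in> {s..t + 1} \<Longrightarrow> t'' \<in> {s..t + 1} \<Longrightarrow> z' \<in> {z} \<Longrightarrow>
       manifold_dist X A h (\<phi> s t' z') (\<phi> s t'' z') \<le> ennreal (C * \<bar>t' - t''\<bar>)"
      by blast
    have "u \<in> {u \<in> topspace (top_of_set {s..t}). \<phi> s u z \<in> U}"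
      if u: "u \<in> {s..t}" "dist u v < m * R / C" for u
    proof -
      have "manifold_dist X A h q (\<phi> s u z) \<le> ennreal (C * \<bar>v - u\<bar>)"
        using C(2)[of s v u z] s u v by (simp add: q_def)
      also have "\<dots> < ennreal (m * R)"
        using u(2) C(1) m(1) R(1)
        by (intro ennreal_lessI) (auto simp: dist_real_def field_simps abs_minus_commute)
      finally have "\<phi> s u z \<in> fst c" "snd c (\<phi> s u z) \<in> cball (snd c q) R"
        using m(2)[of R "\<phi> s u z"] R(1) by (auto simp: dist_norm norm_minus_commute)
      then obtain q' where "q' \<in> fst c \<inter> U" "snd c q' = snd c (\<phi> s u z)"
        using R(2) by (metis imageE subsetD)
      then have "\<phi> s u z \<in> U"
        using chart_inv_left[OF ch] \<open>\<phi> s u z \<in> fst c\<close> by (metis IntE)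
      then show ?thesis using u by simp
    qed
    moreover have "0 < m * R / C" using m C R by simp
    ultimately show "\<exists>e>0. \<forall>x'\<in>{s..t}. dist x' v < e \<longrightarrow>
        x' \<in> {u \<in> topspace (top_of_set {s..t}). \<phi> s u z \<in> U}"
      by blast
  qed auto
qed

text \<open>What matters is that the neighbourhood \<open>V\<close> is the same for all \<open>u\<close> close to \<open>\<tau>\<close>: the Lipschitz
  constant for the initial points in a closed coordinate ball around \<open>p\<close> serves every \<open>u\<close>, so
  one \<open>\<eta>\<close> makes all the maps \<open>\<phi> u \<tau>\<close> close enough to the identity on that ball.\<close>

lemma evolution_family_locally_injective:
  fixes A :: "('a, 'n::finite) chart set"
  assumes man: "complex_manifold X A" and herm: "hermitian_metric X A h"
    and ev: "evolution_family X A h \<phi>"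
    and \<tau>: "0 < \<tau>" and p: "p \<in> topspace X"
  obtains V \<eta> where "openin X V" "p \<in> V" "0 < \<eta>"
    "\<And>u. 0 \<le> u \<Longrightarrow> u \<le> \<tau> \<Longrightarrow> \<tau> - u < \<eta> \<Longrightarrow> inj_on (\<phi> u \<tau>) V"
proof -
  have at: "complex_atlas X A" using man unfolding complex_manifold_def by auto
  obtain c where c: "c \<in> A" "p \<in> fst c" using atlas_covers[OF at p] .
  note ch = atlas_chart[OF at c(1)]
  obtain R where R: "0 < R" "cball (snd c p) R \<subseteq> snd c ` fst c"
    using chart_ball_exists[OF ch c(2)] .
  let ?x = "snd c p"
  obtain m where m: "0 < m"
    "\<And>q q' \<delta>. q \<in> fst c \<Longrightarrow> 0 < \<delta> \<Longrightarrow> dist ?x (snd c q) + \<delta> \<le> R \<Longrightarrow>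
       manifold_dist X A h q q' < ennreal (m * \<delta>) \<Longrightarrow>
       q' \<in> fst c \<and> norm (snd c q' - snd c q) < \<delta>"
    using manifold_dist_controls_chart[OF man herm c(1) R(2)] by blast
  obtain C where C: "0 < C"
    "\<And>s t t' z. 0 \<le> s \<Longrightarrow> t \<in> {s..\<tau>} \<Longrightarrow> t' \<in> {s..\<tau>} \<Longrightarrow> z \<in> chart_inv c ` cball ?x R \<Longrightarrow>
       manifold_dist X A h (\<phi> s t z) (\<phi> s t' z) \<le> ennreal (C * \<bar>t - t'\<bar>)"
    using evolution_family_lipschitz[OF ev \<tau> compactin_chart_inv_image[OF ch compact_cball R(2)]]
    by blast
  \<comment> \<open>Half the ball is kept as room for the displacement by less than \<open>\<delta>\<close>; on the remaining ball
    of radius \<open>R / 2\<close> the criterion for injectivity asks for \<open>4 * CARD('n) * \<delta> < R / 2\<close>.\<close>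
  define \<delta> where "\<delta> = R / (16 * real CARD('n))"
  have n: "1 \<le> real CARD('n)" by (simp add: Suc_leI)
  have \<delta>: "0 < \<delta>" "\<delta> \<le> R / 2" "4 * real CARD('n) * \<delta> < R / 2"
  proof -
    have "4 * real CARD('n) * \<delta> = R / 4" using n by (simp add: \<delta>_def)
    then show "4 * real CARD('n) * \<delta> < R / 2" using R(1) by linarith
    show "0 < \<delta>" using R(1) n by (simp add: \<delta>_def)
    have "1 * \<delta> \<le> real CARD('n) * \<delta>"
      using n \<open>0 < \<delta>\<close> by (intro mult_right_mono) auto
    then show "\<delta> \<le> R / 2" using \<open>4 * real CARD('n) * \<delta> = R / 4\<close> R(1) by linarith
  qed
  define V where "V = {q \<in> fst c. snd c q \<in> ball ?x (R / 2 / 8)}"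
  show thesis
  proof (rule that)
    show "openin X V" unfolding V_def by (rule openin_chart_preimage[OF ch open_ball])
    show "p \<in> V" using c R by (simp add: V_def)
    show "0 < m * \<delta> / C" using m C \<delta> by simp
    fix u assume u: "0 \<le> u" "u \<le> \<tau>" "\<tau> - u < m * \<delta> / C"
    define f where "f = snd c \<circ> \<phi> u \<tau> \<circ> chart_inv c"
    have near: "chart_inv c x \<in> fst c \<inter> \<phi> u \<tau> -` fst c \<and> norm (f x - x) < \<delta>"
      if x: "x \<in> ball ?x (R / 2)" for x
    proof -
      have xR: "x \<in> cball ?x R" using x R by auto
      then have xc: "chart_inv c x \<in> fst c" "snd c (chart_inv c x) = x"
        using chart_inv_right[of x c] R(2) by auto
      then have "\<phi> u u (chart_inv c x) = chart_inv c x"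
        using evolution_family_id[OF ev u(1)] chart_subset_topspace[OF ch] by blast
      then have "manifold_dist X A h (chart_inv c x) (\<phi> u \<tau> (chart_inv c x)) \<le> ennreal (C * \<bar>u - \<tau>\<bar>)"
        using C(2)[of u u \<tau> "chart_inv c x"] u xR by simp
      also have "\<dots> < ennreal (m * \<delta>)"
        using u C(1) m(1) \<delta>(1)
        by (intro ennreal_lessI) (auto simp: field_simps)
      finally show ?thesis
        using m(2)[OF xc(1) \<delta>(1)] xc x \<delta>(2) by (simp add: f_def)
    qed
    have "vec_holomorphic_on f (snd c ` (fst c \<inter> \<phi> u \<tau> -` fst c))"
      using evolution_family_holomorphic[OF ev u(1,2)] c(1)
      unfolding holomorphic_map_def f_def by blast
    moreover have "ball ?x (R / 2) \<subseteq> snd c ` (fst c \<inter> \<phi> u \<tau> -` fst c)"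
    proof
      fix x assume x: "x \<in> ball ?x (R / 2)"
      then have "x \<in> cball ?x R" using R(1) by simp
      then have "snd c (chart_inv c x) = x"
        by (rule chart_inv_right(2)[OF subsetD[OF R(2)]])
      then show "x \<in> snd c ` (fst c \<inter> \<phi> u \<tau> -` fst c)"
        using near[OF x] by (intro image_eqI[of x "snd c" "chart_inv c x"]) simp_all
    qed
    ultimately have "vec_holomorphic_on f (ball ?x (R / 2))"
      unfolding vec_holomorphic_on_def by blast
    then have inj: "inj_on f (ball ?x (R / 2 / 8))"
      using near \<delta> R(1) by (intro holomorphic_near_identity_inj_on[where \<delta> = \<delta>]) (auto simp: less_imp_le)
    show "inj_on (\<phi> u \<tau>) V"
    proof (rule inj_onI)
      fix q q' assume q: "q \<in> V" "q' \<in> V" and eq: "\<phi> u \<tau> q = \<phi> u \<tau> q'"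
      then have "f (snd c q) = f (snd c q')"
        by (simp add: f_def V_def chart_inv_left[OF ch])
      then have "snd c q = snd c q'"
        using inj q by (auto simp: V_def dest: inj_onD)
      then show "q = q'"
        using q chart_inv_left[OF ch] by (metis (mono_tags, lifting) V_def mem_Collect_eq)
    qed
  qed
qed

theorem proposition5p1:
  fixes M :: "'a topology"
    and A :: "('a, 'n::finite) chart set"
    and h :: "'a \<Rightarrow> ('a, 'n) tvec \<Rightarrow> ('a, 'n) tvec \<Rightarrow> complex"
    and \<phi> :: "real \<Rightarrow> real \<Rightarrow> 'a \<Rightarrow> 'a"
  assumes "complex_manifold M A"
    and "hermitian_metric M A h"
    and "taut M A h"
    and "evolution_family M A h \<phi>"
  shows "\<forall>s t. 0 \<le> s \<and> s \<le> t \<longrightarrow> univalent_map M A M A (\<phi> s t)"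
proof (intro allI impI)
  fix s t :: real
  assume st: "0 \<le> s \<and> s \<le> t"
  note man = assms(1) and herm = assms(2) and ev = assms(4)
  have "inj_on (\<phi> s t) (topspace M)"
  proof (rule inj_onI)
    fix z w assume z: "z \<in> topspace M" and w: "w \<in> topspace M" and eq: "\<phi> s t z = \<phi> s t w"
    have cont: "continuous_map (top_of_set {s..t}) M (\<lambda>u. \<phi> s u z)"
      "continuous_map (top_of_set {s..t}) M (\<lambda>u. \<phi> s u w)"
      using trajectory_continuous[OF man herm ev] st z w by auto
    define E where "E = {u \<in> {s..t}. \<phi> s u z = \<phi> s u w}"
    have "closedin (top_of_set {s..t}) E"
      using closedin_continuous_maps_eq[OF _ cont] man by (simp add: E_def complex_manifold_def)
    then have "compact E" by (metis closedin_compact compact_Icc)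
    moreover have "E \<noteq> {}" using eq st by (auto simp: E_def)
    ultimately obtain \<tau> where \<tau>: "\<tau> \<in> E" "\<And>u. u \<in> E \<Longrightarrow> \<tau> \<le> u"
      using compact_attains_inf by metis
    have \<tau>st: "s \<le> \<tau>" "\<tau> \<le> t" and meet: "\<phi> s \<tau> z = \<phi> s \<tau> w"
      using \<tau>(1) by (auto simp: E_def)
    have "\<tau> = s"
    proof (rule ccontr)
      assume "\<tau> \<noteq> s"
      then have s\<tau>: "s < \<tau>" using \<tau>st by simp
      have "0 < \<tau>" "\<phi> s \<tau> z \<in> topspace M"
        using s\<tau> st evolution_family_maps[OF ev _ _ z] by auto
      from evolution_family_locally_injective[OF man herm ev this]
      obtain V \<eta> where V: "openin M V" "\<phi> s \<tau> z \<in> V" "0 < \<eta>"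
        "\<And>u. 0 \<le> u \<Longrightarrow> u \<le> \<tau> \<Longrightarrow> \<tau> - u < \<eta> \<Longrightarrow> inj_on (\<phi> u \<tau>) V"
        by blast
      have near: "\<exists>e>0. \<forall>u\<in>{s..t}. dist u \<tau> < e \<longrightarrow> \<phi> s u y \<in> V"
        if "continuous_map (top_of_set {s..t}) M (\<lambda>u. \<phi> s u y)" "\<phi> s \<tau> y \<in> V" for y
      proof -
        have "openin (top_of_set {s..t}) {u \<in> topspace (top_of_set {s..t}). \<phi> s u y \<in> V}"
          using that V(1) by (intro openin_continuous_map_preimage)
        then show ?thesis
          unfolding openin_euclidean_subtopology_iff using that(2) \<tau>st by auto
      qed
      obtain e1 e2 where e: "0 < e1" "0 < e2"
        "\<And>u. u \<in> {s..t} \<Longrightarrow> dist u \<tau> < e1 \<Longrightarrow> \<phi> s u z \<in> V"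
        "\<And>u. u \<in> {s..t} \<Longrightarrow> dist u \<tau> < e2 \<Longrightarrow> \<phi> s u w \<in> V"
        using near[OF cont(1)] near[OF cont(2)] V(2) meet by metis
      obtain u where u: "max s (max (\<tau> - \<eta>) (max (\<tau> - e1) (\<tau> - e2))) < u" "u < \<tau>"
        using dense[of "max s (max (\<tau> - \<eta>) (max (\<tau> - e1) (\<tau> - e2)))" \<tau>] s\<tau> V(3) e(1,2) by auto
      have "\<phi> u \<tau> (\<phi> s u z) = \<phi> s \<tau> z" "\<phi> u \<tau> (\<phi> s u w) = \<phi> s \<tau> w"
        using evolution_family_compose[OF ev, of s u \<tau>] u st z w by auto
      moreover have "\<phi> s u z \<in> V" "\<phi> s u w \<in> V"
        using e(3,4)[of u] u \<tau>st by (auto simp: dist_real_def)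
      moreover have "inj_on (\<phi> u \<tau>) V" using V(4)[of u] u st by auto
      ultimately have "\<phi> s u z = \<phi> s u w" using meet by (metis inj_onD)
      then have "u \<in> E" using u \<tau>st by (auto simp: E_def)
      then show False using \<tau>(2)[of u] u by simp
    qed
    then show "z = w"
      using meet evolution_family_id[OF ev] st z w by simp
  qed
  moreover have "holomorphic_map M A M A (\<phi> s t)"
    using evolution_family_holomorphic[OF ev] st by blast
  ultimately show "univalent_map M A M A (\<phi> s t)"
    by (simp add: univalent_map_def)
qed

end
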